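(* Let $p\geq 3$ be a prime, let $c\in\mathbb{Z}_p$, and let $f_c(z)=z^2+c$. Suppose that $0$ is strictly pre-periodic modulo $p$ under $f_c$, with orbit type $(m,n)$ (mod $p$), $m>0$. Then one of the following holds. (A) $0$ has orbit type $(m,n)$ over $\mathbb{Z}_p$. (B) There exist an integer $k\geq 1$ and a positive integer $r$, with $r\mid (p-1)$ if $p\neq 3$ and $r=p=3$ if $p=3$, such that (1) $0$ has orbit type $(m,n)$ (mod $p^i$) for all $1\le i\leq k$, and (2) $0$ has orbit type $(m,rn)$ (mod $p^j$) for all $j>k$. (C) $0$ has infinite orbit under $f_c$ in $\mathbb{Z}_p$, and $0$ has orbit type $(m,n_i)$ (mod $p^i$) for all $i\geq 1$, where $n_i$ is the length of the cycle on which $0$ lands when its orbit is calculated (mod $p^i$). That is, if neither (A) nor (B) holds, then (C) holds.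
   Context: $f_c^j$ denotes the $j$-th iterate of $f_c$. The orbit of $0$ (the critical orbit) is $0, f_c(0), f_c^2(0),\dots$. If this orbit is finite over $\mathbb{Z}_p$, the orbit type of $0$ is the minimal pair $(m,n)$ with $m\ge 0$, $n\ge 1$ and $f_c^{m+n}(0)=f_c^m(0)$ (that is, $m$ is the tail length and $n$ the exact length of the cycle reached). The orbit type of $0$ (mod $p^i$) is the minimal such pair for the map induced by $f_c$ on $\mathbb{Z}_p/p^i\mathbb{Z}_p$, i.e. with $f_c^{m+n}(0)\equiv f_c^m(0)$ (mod $p^i$). The point $0$ is strictly pre-periodic if its orbit type has $m>0$. *)

theory Defs
  imports "HOL-Algebra.QuotRing" "HOL-Computational_Algebra.Primes"
begin

section \<open>The ring of p-adic integers\<close>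

text \<open>
  The inverse limit of the rings \<open>\<int>/p\<^sup>i\<int>\<close>: a p-adic integer is a coherent sequence whose \<open>i\<close>-th
  entry is the representative in \<open>{0..<p\<^sup>i}\<close> of its residue modulo \<open>p\<^sup>i\<close>. The entry at index \<open>0\<close>
  lives in the trivial ring and is always \<open>0\<close>.
\<close>

definition Zp :: "nat \<Rightarrow> (nat \<Rightarrow> int) ring" where
  "Zp p =
    \<lparr>carrier = {x. \<forall>i. x i \<in> {0..<int p ^ i} \<and> x (Suc i) mod int p ^ i = x i},
     monoid.mult = (\<lambda>x y i. (x i * y i) mod int p ^ i),
     one = (\<lambda>i. 1 mod int p ^ i),
     zero = (\<lambda>i. 0),
     add = (\<lambda>x y i. (x i + y i) mod int p ^ i)\<rparr>"

definition Zp_pow_ideal :: "nat \<Rightarrow> nat \<Rightarrow> (nat \<Rightarrow> int) set" where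
  "Zp_pow_ideal p i = PIdl\<^bsub>Zp p\<^esub> (add_pow (Zp p) (p ^ i) \<one>\<^bsub>Zp p\<^esub>)"


section \<open>Quadratic maps and orbit types\<close>

definition quad_map :: "('a, 'b) ring_scheme \<Rightarrow> 'a \<Rightarrow> 'a \<Rightarrow> 'a" where
  "quad_map R c z = z [^]\<^bsub>R\<^esub> (2::nat) \<oplus>\<^bsub>R\<^esub> c"

text \<open>
  Minimality of the pair is componentwise. Such a least pair exists whenever the orbit is finite:
  if \<open>m\<close> is the tail length and \<open>n\<close> the exact cycle length, then the pairs \<open>(m', n')\<close> with
  \<open>n' \<ge> 1\<close> and \<open>f\<^bsup>m'+n'\<^esup>(x) = f\<^bsup>m'\<^esup>(x)\<close> are those with \<open>m \<le> m'\<close> and \<open>n dvd n'\<close>.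
\<close>

definition orbit_type :: "('a \<Rightarrow> 'a) \<Rightarrow> 'a \<Rightarrow> nat \<Rightarrow> nat \<Rightarrow> bool" where
  "orbit_type f x m n \<longleftrightarrow>
     n \<ge> 1 \<and> (f ^^ (m + n)) x = (f ^^ m) x \<and>
     (\<forall>m' n'. n' \<ge> 1 \<and> (f ^^ (m' + n')) x = (f ^^ m') x \<longrightarrow> m \<le> m' \<and> n \<le> n')"

definition critical_orbit_type :: "nat \<Rightarrow> (nat \<Rightarrow> int) \<Rightarrow> nat \<Rightarrow> nat \<Rightarrow> bool" where
  "critical_orbit_type p c m n \<longleftrightarrow> orbit_type (quad_map (Zp p) c) \<zero>\<^bsub>Zp p\<^esub> m n"

text \<open>
  The map induced by \<open>z \<mapsto> z\<^sup>2 + c\<close> on \<open>\<int>\<^sub>p/p\<^sup>i\<int>\<^sub>p\<close> is the quadratic map of the quotient ring whose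
  constant term is the coset of \<open>c\<close>.
\<close>

definition critical_orbit_type_mod ::
    "nat \<Rightarrow> nat \<Rightarrow> (nat \<Rightarrow> int) \<Rightarrow> nat \<Rightarrow> nat \<Rightarrow> bool" where
  "critical_orbit_type_mod p i c m n \<longleftrightarrow>
     (let I = Zp_pow_ideal p i; Q = Zp p Quot I
      in orbit_type (quad_map Q (I +>\<^bsub>Zp p\<^esub> c)) \<zero>\<^bsub>Q\<^esub> m n)"

definition critical_orbit :: "nat \<Rightarrow> (nat \<Rightarrow> int) \<Rightarrow> (nat \<Rightarrow> int) set" where
  "critical_orbit p c = range (\<lambda>j. (quad_map (Zp p) c ^^ j) \<zero>\<^bsub>Zp p\<^esub>)"


section \<open>Basic facts\<close>

lemma Zp_simps:
  "x \<in> carrier (Zp p) \<longleftrightarrow>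
     (\<forall>i. 0 \<le> x i \<and> x i < int p ^ i \<and> x (Suc i) mod int p ^ i = x i)"
  "x \<otimes>\<^bsub>Zp p\<^esub> y = (\<lambda>i. (x i * y i) mod int p ^ i)"
  "x \<oplus>\<^bsub>Zp p\<^esub> y = (\<lambda>i. (x i + y i) mod int p ^ i)"
  "\<one>\<^bsub>Zp p\<^esub> = (\<lambda>i. 1 mod int p ^ i)"
  "\<zero>\<^bsub>Zp p\<^esub> = (\<lambda>i. 0)"
  by (auto simp: Zp_def)

lemma mod_pow_Suc: "(a mod int p ^ Suc i) mod int p ^ i = a mod int p ^ i"
  by (rule mod_mod_cancel) simp

lemma Zp_closedI:
  assumes "p > 0" "\<And>i. g (Suc i) mod int p ^ i = g i mod int p ^ i"
  shows "(\<lambda>i. g i mod int p ^ i) \<in> carrier (Zp p)"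
  using assms by (simp add: Zp_simps mod_pow_Suc del: power_Suc)

lemma Zp_Suc:
  assumes "x \<in> carrier (Zp p)"
  shows "x (Suc i) mod int p ^ i = x i"
  using assms by (simp add: Zp_simps)

lemma Zp_mod:
  assumes "x \<in> carrier (Zp p)"
  shows "x i mod int p ^ i = x i"
  using assms by (simp add: Zp_simps)

lemma cring_Zp:
  assumes "p > 0"
  shows "cring (Zp p)"
proof (rule cringI)
  show "abelian_group (Zp p)"
  proof (rule abelian_groupI)
    fix x y assume xy: "x \<in> carrier (Zp p)" "y \<in> carrier (Zp p)"
    show "x \<oplus>\<^bsub>Zp p\<^esub> y \<in> carrier (Zp p)"
      unfolding Zp_simps(3) using assms
    proof (rule Zp_closedI)
      fix i show "(x (Suc i) + y (Suc i)) mod int p ^ i = (x i + y i) mod int p ^ i"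
        by (metis mod_add_eq Zp_Suc[OF xy(1)] Zp_Suc[OF xy(2)])
    qed
  next
    fix x assume x: "x \<in> carrier (Zp p)"
    show "\<exists>y\<in>carrier (Zp p). y \<oplus>\<^bsub>Zp p\<^esub> x = \<zero>\<^bsub>Zp p\<^esub>"
    proof
      show "(\<lambda>i. (- x i) mod int p ^ i) \<in> carrier (Zp p)"
        using assms
      proof (rule Zp_closedI)
        fix i show "(- x (Suc i)) mod int p ^ i = (- x i) mod int p ^ i"
          by (metis mod_minus_eq Zp_Suc[OF x])
      qed
    qed (simp add: Zp_simps mod_simps)
  qed (use assms in \<open>auto simp: Zp_simps mod_simps ac_simps\<close>)
next
  show "comm_monoid (Zp p)"
  proof (rule comm_monoidI)
    fix x y assume xy: "x \<in> carrier (Zp p)" "y \<in> carrier (Zp p)"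
    show "x \<otimes>\<^bsub>Zp p\<^esub> y \<in> carrier (Zp p)"
      unfolding Zp_simps(2) using assms
    proof (rule Zp_closedI)
      fix i show "(x (Suc i) * y (Suc i)) mod int p ^ i = (x i * y i) mod int p ^ i"
        by (metis mod_mult_eq Zp_Suc[OF xy(1)] Zp_Suc[OF xy(2)])
    qed
  next
    show "\<one>\<^bsub>Zp p\<^esub> \<in> carrier (Zp p)"
      unfolding Zp_simps(4) using assms by (rule Zp_closedI) simp
  qed (auto simp: Zp_simps mod_simps ac_simps)
qed (auto simp: Zp_simps mod_simps algebra_simps)

lemma Zp_pow_const:
  "add_pow (Zp p) k \<one>\<^bsub>Zp p\<^esub> = (\<lambda>j. int k mod int p ^ j)" if "p > 0" for k :: nat
proof -
  interpret cring "Zp p" using cring_Zp[OF that] .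
  show ?thesis
  proof (induction k)
    case 0 then show ?case by (simp add: Zp_simps)
  next
    case (Suc k)
    have "add_pow (Zp p) (Suc k) \<one>\<^bsub>Zp p\<^esub> = add_pow (Zp p) k \<one>\<^bsub>Zp p\<^esub> \<oplus>\<^bsub>Zp p\<^esub> \<one>\<^bsub>Zp p\<^esub>"
      by simp
    then show ?case by (simp only: Suc) (simp add: Zp_simps mod_simps algebra_simps)
  qed
qed

lemma Zp_mod_le:
  assumes x: "x \<in> carrier (Zp p)" and "i \<le> j"
  shows "x j mod int p ^ i = x i"
  using \<open>i \<le> j\<close>
proof (induction j rule: dec_induct)
  case base show ?case using Zp_mod[OF x] .
next
  case (step j)
  have "x (Suc j) mod int p ^ i = x (Suc j) mod int p ^ j mod int p ^ i"
    using step by (simp add: mod_mod_cancel le_imp_power_dvd)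
  then show ?case using step Zp_Suc[OF x] by simp
qed

lemma Zp_pow_ideal_iff:
  assumes "p > 0" "x \<in> carrier (Zp p)"
  shows "x \<in> Zp_pow_ideal p i \<longleftrightarrow> x i = 0"
proof
  assume "x \<in> Zp_pow_ideal p i"
  then show "x i = 0"
    by (auto simp: Zp_pow_ideal_def cgenideal_def Zp_pow_const[OF assms(1)] Zp_simps(2))
next
  assume x0: "x i = 0"
  define y where "y = (\<lambda>j. (x (i + j) div int p ^ i) mod int p ^ j)"
  have dvd: "int p ^ i dvd x (i + j)" for j
    using Zp_mod_le[OF assms(2), of i "i + j"] x0 by (simp add: dvd_eq_mod_eq_0)
  have y: "y \<in> carrier (Zp p)"
    unfolding y_def using assms(1)
  proof (rule Zp_closedI)
    fix j
    have "x (i + Suc j) mod (int p ^ i * int p ^ j) = x (i + j)"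
      using Zp_mod_le[OF assms(2), of "i + j" "i + Suc j"] by (simp add: power_add)
    moreover obtain u v where "x (i + Suc j) = int p ^ i * u" "x (i + j) = int p ^ i * v"
      using dvd[of j] dvd[of "Suc j"] by (auto elim!: dvdE)
    ultimately show "x (i + Suc j) div int p ^ i mod int p ^ j = x (i + j) div int p ^ i mod int p ^ j"
      using assms(1) by (auto simp: mod_mult_mult1)
  qed
  have "x = y \<otimes>\<^bsub>Zp p\<^esub> (add_pow (Zp p) (p ^ i) \<one>\<^bsub>Zp p\<^esub>)"
  proof
    fix j
    have "(y \<otimes>\<^bsub>Zp p\<^esub> (add_pow (Zp p) (p ^ i) \<one>\<^bsub>Zp p\<^esub>)) j
        = (x (i + j) div int p ^ i * int p ^ i) mod int p ^ j"
      by (simp add: Zp_simps(2) Zp_pow_const[OF assms(1)] y_def mod_simps)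
    also have "\<dots> = x (i + j) mod int p ^ j" using dvd[of j] by simp
    also have "\<dots> = x j" using Zp_mod_le[OF assms(2), of j "i + j"] by simp
    finally show "x j = (y \<otimes>\<^bsub>Zp p\<^esub> (add_pow (Zp p) (p ^ i) \<one>\<^bsub>Zp p\<^esub>)) j" ..
  qed
  then show "x \<in> Zp_pow_ideal p i"
    using y by (auto simp: Zp_pow_ideal_def cgenideal_def)
qed

lemma ideal_Zp_pow_ideal:
  assumes "p > 0"
  shows "ideal (Zp_pow_ideal p i) (Zp p)"
proof -
  interpret cring "Zp p" using cring_Zp[OF assms] .
  show ?thesis unfolding Zp_pow_ideal_def by (intro cgenideal_ideal) simp
qed

lemma Zp_coset_eq_iff:
  assumes "p > 0" "x \<in> carrier (Zp p)" "y \<in> carrier (Zp p)"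
  shows "Zp_pow_ideal p i +>\<^bsub>Zp p\<^esub> x = Zp_pow_ideal p i +>\<^bsub>Zp p\<^esub> y \<longleftrightarrow> x i = y i"
proof -
  interpret cring "Zp p" using cring_Zp[OF assms(1)] .
  have c: "x \<ominus>\<^bsub>Zp p\<^esub> y \<in> carrier (Zp p)" using assms by simp
  have "x = (x \<ominus>\<^bsub>Zp p\<^esub> y) \<oplus>\<^bsub>Zp p\<^esub> y" using assms(2,3) by algebra
  then have eq: "x i = ((x \<ominus>\<^bsub>Zp p\<^esub> y) i + y i) mod int p ^ i" by (metis Zp_simps(3))
  have "x \<ominus>\<^bsub>Zp p\<^esub> y \<in> Zp_pow_ideal p i \<longleftrightarrow> (x \<ominus>\<^bsub>Zp p\<^esub> y) i = 0"
    using Zp_pow_ideal_iff[OF assms(1) c] .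
  also have "\<dots> \<longleftrightarrow> x i = y i"
  proof
    assume "(x \<ominus>\<^bsub>Zp p\<^esub> y) i = 0"
    then show "x i = y i" using eq Zp_mod[OF assms(3)] by simp
  next
    assume "x i = y i"
    then have "((x \<ominus>\<^bsub>Zp p\<^esub> y) i + y i) mod int p ^ i = y i mod int p ^ i"
      using eq Zp_mod[OF assms(3)] by simp
    then have "int p ^ i dvd (x \<ominus>\<^bsub>Zp p\<^esub> y) i" by (simp add: mod_eq_dvd_iff)
    then show "(x \<ominus>\<^bsub>Zp p\<^esub> y) i = 0" using Zp_mod[OF c, of i] by (simp add: dvd_eq_mod_eq_0)
  qed
  finally show ?thesis
    using quotient_eq_iff_same_a_r_cos[OF ideal_Zp_pow_ideal[OF assms(1)] assms(2,3)] by blast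
qed

lemma quad_map_closed:
  assumes "ring R" "c \<in> carrier R" "z \<in> carrier R"
  shows "(quad_map R c ^^ j) z \<in> carrier R"
proof -
  interpret ring R by fact
  show ?thesis using assms(2,3) by (induction j) (auto simp: quad_map_def)
qed

lemma quad_map_Quot:
  assumes "ideal I R" "c \<in> carrier R"
  shows "(quad_map (R Quot I) (I +>\<^bsub>R\<^esub> c) ^^ j) \<zero>\<^bsub>R Quot I\<^esub> = I +>\<^bsub>R\<^esub> ((quad_map R c ^^ j) \<zero>\<^bsub>R\<^esub>)"
proof -
  interpret ideal I R by fact
  interpret h: ring_hom_ring R "R Quot I" "(+>\<^bsub>R\<^esub>) I"
    by (rule rcos_ring_hom_ring)
  have step: "quad_map (R Quot I) (I +>\<^bsub>R\<^esub> c) (I +>\<^bsub>R\<^esub> z) = I +>\<^bsub>R\<^esub> quad_map R c z"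
    if "z \<in> carrier R" for z
    using that assms(2) by (simp add: quad_map_def numeral_2_eq_2)
  show ?thesis
  proof (induction j)
    case 0 show ?case using h.hom_zero by simp
  next
    case (Suc j)
    have "(quad_map R c ^^ j) \<zero>\<^bsub>R\<^esub> \<in> carrier R"
      using quad_map_closed[OF ring_axioms assms(2)] by simp
    then show ?case by (simp add: Suc step)
  qed
qed

lemma critical_orbit_type_mod_iff:
  assumes "p > 0" "c \<in> carrier (Zp p)"
  defines "f \<equiv> \<lambda>j. (quad_map (Zp p) c ^^ j) \<zero>\<^bsub>Zp p\<^esub>"
  shows "critical_orbit_type_mod p i c m n \<longleftrightarrow>
     n \<ge> 1 \<and> f (m + n) i = f m i \<and>
     (\<forall>m' n'. n' \<ge> 1 \<and> f (m' + n') i = f m' i \<longrightarrow> m \<le> m' \<and> n \<le> n')"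
proof -
  interpret cring "Zp p" using cring_Zp[OF assms(1)] .
  have cl: "f j \<in> carrier (Zp p)" for j
    unfolding f_def by (rule quad_map_closed[OF ring_axioms assms(2)]) simp
  show ?thesis
    unfolding critical_orbit_type_mod_def Let_def orbit_type_def
      quad_map_Quot[OF ideal_Zp_pow_ideal[OF assms(1)] assms(2)] f_def[symmetric]
    by (simp only: f_def[THEN meta_eq_to_obj_eq, THEN fun_cong, symmetric]
        Zp_coset_eq_iff[OF assms(1) cl cl])
qed

end

theory Submission
  imports Defs "HOL-Number_Theory.Number_Theory"
begin

text \<open>
  The critical point is not periodic modulo \<open>p\<close>, so no later point of its orbit is divisible by \<open>p\<close>
  and, \<open>p\<close> being odd, \<open>f\<close> has unit derivative there. Therefore \<open>f\<close> is injective on the residue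
  classes modulo \<open>p\<close> of the points of the cycle, and the tail of the orbit has length \<open>m\<close> modulo every
  power of \<open>p\<close> (\<open>ex_mod_type\<close>). This settles the case of an infinite orbit; there remains the case
  that \<open>x = f\<^sup>m(0)\<close> is a periodic point in the p-adic integers.

  Let \<open>g = f\<^sup>n\<close>, which fixes \<open>x\<close> modulo \<open>p\<close>, and let \<open>\<lambda> = g'(x)\<close>. If \<open>g(x) = x\<close>, the orbit type is
  \<open>(m, n)\<close>. Otherwise \<open>g(x) = x + p\<^sup>k u\<close> with \<open>k \<ge> 1\<close> and a unit \<open>u\<close>, and modulo \<open>p\<^sup>k\<^sup>+\<^sup>1\<close> the map \<open>g\<close> sends
  \<open>x + p\<^sup>k t\<close> to \<open>x + p\<^sup>k (u + \<lambda> t)\<close>. The cycle length thus becomes \<open>r n\<close>, where \<open>r\<close> is the order of \<open>\<lambda>\<close>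
  modulo \<open>p\<close>, or \<open>p\<close> if \<open>\<lambda> \<equiv> 1\<close> (\<open>return_next_level_iff\<close>).

  The decisive fact is \<open>never_returns\<close>: if an iterate \<open>h\<close> of \<open>f\<close> has \<open>h'(x) \<equiv> 1\<close> modulo \<open>p\<close>, and \<open>h(x) - x\<close>
  has finite valuation \<open>k \<ge> 1\<close>, then the valuation of \<open>h\<^sup>e(x) - x\<close> is \<open>k\<close> plus that of \<open>e\<close>, provided that
  \<open>p \<ge> 5\<close> or \<open>k \<ge> 2\<close>; in particular \<open>x\<close> is not periodic. It comes from the second-order Taylor
  expansion of \<open>h\<close>, summed along \<open>p\<close> iterations. Applied to \<open>g\<close>, it shows that \<open>\<lambda> \<equiv> 1\<close> occurs only for
  \<open>p = 3\<close> and \<open>k = 1\<close>, and since \<open>\<lambda> \<equiv> 1\<close> always holds for \<open>p = 3\<close>, this gives the stated values of \<open>r\<close>.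
  Applied to \<open>g\<^sup>r\<close>, which fixes \<open>x\<close> modulo \<open>p\<^sup>k\<^sup>+\<^sup>1\<close> and has derivative \<open>\<lambda>\<^sup>r \<equiv> 1\<close>, it shows that
  \<open>g\<^sup>r(x) = x\<close>, so that the cycle length does not grow any further.

  The valuation estimates are carried out for integers: at any finite level the constant term is an
  integer, and a contradiction at one sufficiently high level is enough.
\<close>

section \<open>Iterates of integer maps near an almost fixed point\<close>

definition quad :: "int \<Rightarrow> int \<Rightarrow> int" where
  "quad c z = z\<^sup>2 + c"

text \<open>
  The second-order Taylor expansion of \<open>h\<close> at \<open>x\<close>, with derivative \<open>d\<close> and half second
  derivative \<open>b\<close>. The coefficient \<open>b\<close> must be the same for all increments \<open>y\<close>; only the cubic
  remainder may vary with \<open>y\<close>.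
\<close>

definition jet2 :: "(int \<Rightarrow> int) \<Rightarrow> int \<Rightarrow> int \<Rightarrow> int \<Rightarrow> bool" where
  "jet2 h x d b \<longleftrightarrow> (\<forall>y. \<exists>e. h (x + y) = h x + d * y + b * y\<^sup>2 + e * y ^ 3)"

definition multiplier :: "int \<Rightarrow> nat \<Rightarrow> int \<Rightarrow> int" where
  "multiplier c N x = (\<Prod>i<N. 2 * (quad c ^^ i) x)"

text \<open>
  Chain rule: composing with \<open>z \<mapsto> z\<^sup>2 + c\<close> multiplies the linear coefficient by twice the
  current value, and the quadratic coefficient remains independent of the increment.
\<close>

lemma jet2_quad_iterate: "\<exists>b. jet2 (quad c ^^ N) x (multiplier c N x) b"
proof (induction N)
  case 0
  show ?case by (auto simp: jet2_def multiplier_def intro!: exI[of _ 0])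
next
  case (Suc N)
  let ?h = "quad c ^^ N"
  obtain b where b: "jet2 ?h x (multiplier c N x) b" using Suc.IH by blast
  define A d where "A = ?h x" and "d = multiplier c N x"
  have "\<exists>e. (quad c ^^ Suc N) (x + y) =
      (quad c ^^ Suc N) x + (2 * A * d) * y + (2 * A * b + d\<^sup>2) * y\<^sup>2 + e * y ^ 3" for y
  proof -
    obtain e where e: "?h (x + y) = A + d * y + b * y\<^sup>2 + e * y ^ 3"
      using b unfolding jet2_def A_def d_def by blast
    have "(quad c ^^ Suc N) (x + y) = (A + d * y + b * y\<^sup>2 + e * y ^ 3)\<^sup>2 + c"
      using e by (simp add: quad_def)
    also have "\<dots> = (A\<^sup>2 + c) + (2 * A * d) * y + (2 * A * b + d\<^sup>2) * y\<^sup>2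
        + (2 * A * e + 2 * d * b + (b\<^sup>2 + 2 * d * e) * y + 2 * b * e * y\<^sup>2 + e\<^sup>2 * y ^ 3) * y ^ 3"
      by (simp add: algebra_simps power2_eq_square power3_eq_cube)
    finally show ?thesis by (auto simp: A_def quad_def)
  qed
  moreover have "multiplier c (Suc N) x = 2 * A * d"
    by (simp add: multiplier_def A_def d_def)
  ultimately show ?case unfolding jet2_def by auto
qed

text \<open>
  On the residue class \<open>x + q\<int>\<close>, written in the coordinate \<open>t\<close>, the map \<open>h\<close> is modulo \<open>p\<close> the
  affine map \<open>t \<mapsto> u + d t\<close>, since the quadratic term acquires a factor \<open>q\<close> divisible by \<open>p\<close>.
  Iterating it from \<open>0\<close> gives a geometric sum.
\<close>

lemma iterate_first_order:
  assumes "jet2 h x d b" "h x = x + q * u" "p dvd q" "q \<noteq> 0"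
  shows "\<exists>t. (h ^^ j) x = x + q * t \<and> [t = u * (\<Sum>i<j. d ^ i)] (mod p)"
proof (induction j)
  case 0
  show ?case by (intro exI[of _ 0]) simp
next
  case (Suc j)
  obtain t where t: "(h ^^ j) x = x + q * t" "[t = u * (\<Sum>i<j. d ^ i)] (mod p)"
    using Suc.IH by blast
  obtain e where e: "h (x + q * t) = h x + d * (q * t) + b * (q * t)\<^sup>2 + e * (q * t) ^ 3"
    using assms(1) unfolding jet2_def by blast
  define s where "s = u + d * t + q * (b * t\<^sup>2 + e * q * t ^ 3)"
  have "(h ^^ Suc j) x = x + q * s"
    using t(1) e assms(2) by (simp add: s_def algebra_simps power2_eq_square power3_eq_cube)
  moreover have "[s = u * (\<Sum>i<Suc j. d ^ i)] (mod p)"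
  proof -
    have "[s = u + d * t + 0 * (b * t\<^sup>2 + e * q * t ^ 3)] (mod p)"
      unfolding s_def using assms(3)
      by (intro cong_add cong_mult cong_refl) (simp add: cong_0_iff)
    also have "u + d * t + 0 * (b * t\<^sup>2 + e * q * t ^ 3) = u + d * t" by simp
    also have "[u + d * t = u + d * (u * (\<Sum>i<j. d ^ i))] (mod p)"
      by (intro cong_add cong_mult cong_refl t(2))
    also have "u + d * (u * (\<Sum>i<j. d ^ i)) = u * (\<Sum>i<Suc j. d ^ i)"
      by (simp only: sum.lessThan_Suc_shift)
         (simp add: sum_distrib_left algebra_simps)
    finally show ?thesis .
  qed
  ultimately show ?case by blast
qed

text \<open>
  When \<open>d \<equiv> 1\<close>, the affine approximation is the translation \<open>t \<mapsto> t + u\<close>, whose \<open>p\<close>-th iterate is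
  the identity modulo \<open>p\<close>; one more power of \<open>p\<close> is needed to see how far that iterate moves
  \<open>x\<close>. In the correction terms \<open>t\<close> may be replaced by its leading part \<open>j u\<close>, because they
  already have a factor \<open>p\<close>; this produces the sums of \<open>i\<close> and \<open>i\<^sup>2\<close>.
\<close>

lemma iterate_second_order:
  assumes "jet2 h x d b" "h x = x + q * u" "p dvd q" "[d = 1] (mod p)"
  shows "\<exists>t. (h ^^ j) x = x + q * t \<and>
    [t = int j * u + (d - 1) * u * (\<Sum>i<j. int i) + q * b * u\<^sup>2 * (\<Sum>i<j. (int i)\<^sup>2)] (mod p\<^sup>2)"
proof (induction j)
  case 0
  show ?case by (intro exI[of _ 0]) simp
next
  case (Suc j)
  let ?A = "\<Sum>i<j. int i" and ?B = "\<Sum>i<j. (int i)\<^sup>2"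
  obtain t where t: "(h ^^ j) x = x + q * t"
      "[t = int j * u + (d - 1) * u * ?A + q * b * u\<^sup>2 * ?B] (mod p\<^sup>2)"
    using Suc.IH by blast
  obtain e where e: "h (x + q * t) = h x + d * (q * t) + b * (q * t)\<^sup>2 + e * (q * t) ^ 3"
    using assms(1) unfolding jet2_def by blast
  obtain v where v: "q = p * v" using assms(3) by blast
  obtain a where a: "d - 1 = p * a" using assms(4) by (auto simp: cong_iff_dvd_diff)
  \<comment> \<open>\<open>p z\<close> is the deviation of \<open>t\<close> from its leading part \<open>j u\<close>.\<close>
  obtain w where w: "t = int j * u + p * a * u * ?A + p * v * b * u\<^sup>2 * ?B + p\<^sup>2 * w"
  proof -
    have "p\<^sup>2 dvd t - (int j * u + p * a * u * ?A + p * v * b * u\<^sup>2 * ?B)"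
      using t(2) unfolding cong_iff_dvd_diff a v by (simp add: mult.assoc)
    then obtain w where "t - (int j * u + p * a * u * ?A + p * v * b * u\<^sup>2 * ?B) = p\<^sup>2 * w" ..
    then show ?thesis using that[of w] by simp
  qed
  define z where "z = a * u * ?A + v * b * u\<^sup>2 * ?B + p * w"
  have tz: "t = int j * u + p * z" unfolding w z_def by (simp add: algebra_simps power2_eq_square)
  define s where "s = u + d * t + q * b * t\<^sup>2 + e * q\<^sup>2 * t ^ 3"
  have "(h ^^ Suc j) x = x + q * s"
    using t(1) e assms(2) by (simp add: s_def algebra_simps power2_eq_square power3_eq_cube)
  moreover have "[s = int (Suc j) * u + (d - 1) * u * (\<Sum>i<Suc j. int i)
      + q * b * u\<^sup>2 * (\<Sum>i<Suc j. (int i)\<^sup>2)] (mod p\<^sup>2)"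
  proof -
    have "s - (int (Suc j) * u + (d - 1) * u * (\<Sum>i<Suc j. int i)
      + q * b * u\<^sup>2 * (\<Sum>i<Suc j. (int i)\<^sup>2))
      = t + (d - 1) * t + q * b * t\<^sup>2 + e * q\<^sup>2 * t ^ 3 - (int j * u + (d - 1) * u * (?A + int j)
      + q * b * u\<^sup>2 * (?B + (int j)\<^sup>2))"
      by (simp add: s_def algebra_simps)
    also have "\<dots> = p\<^sup>2 * w + p * a * (t - int j * u) + p * v * b * (t\<^sup>2 - (int j * u)\<^sup>2)
       + p\<^sup>2 * (e * v\<^sup>2 * t ^ 3)"
      unfolding a v by (subst (1) w) (simp add: algebra_simps power2_eq_square)
    also have "t - int j * u = p * z" using tz by simp
    also have "t\<^sup>2 - (int j * u)\<^sup>2 = p * z * (2 * (int j * u) + p * z)"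
      by (simp add: tz algebra_simps power2_eq_square)
    also have "p\<^sup>2 * w + p * a * (p * z) + p * v * b * (p * z * (2 * (int j * u) + p * z))
       + p\<^sup>2 * (e * v\<^sup>2 * t ^ 3) = p\<^sup>2 * (w + a * z + v * b * (z * (2 * (int j * u) + p * z)) + e * v\<^sup>2 * t ^ 3)"
      by (simp add: algebra_simps power2_eq_square)
    finally show ?thesis by (simp add: cong_iff_dvd_diff)
  qed
  ultimately show ?case by blast
qed

lemma sum_below_odd_prime:
  assumes "prime p" "p \<ge> 3"
  shows "int p dvd (\<Sum>i<p. int i)"
proof -
  have "2 * (\<Sum>i<j. int i) = int j * (int j - 1)" for j :: nat
    by (induction j) (simp_all add: algebra_simps)
  then have "int p dvd 2 * (\<Sum>i<p. int i)" by simp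
  moreover have "\<not> int p dvd 2" using assms(2) zdvd_imp_le[of "int p" 2] by auto
  ultimately show ?thesis using assms(1) by (simp add: prime_dvd_mult_iff)
qed

lemma sum_squares_below_prime:
  assumes "prime p" "p \<ge> 5"
  shows "int p dvd (\<Sum>i<p. (int i)\<^sup>2)"
proof -
  have "6 * (\<Sum>i<j. (int i)\<^sup>2) = int j * ((int j - 1) * (2 * int j - 1))" for j :: nat
    by (induction j) (simp_all add: algebra_simps power2_eq_square)
  then have "int p dvd 6 * (\<Sum>i<p. (int i)\<^sup>2)" by simp
  then have "int p dvd 2 * (3 * (\<Sum>i<p. (int i)\<^sup>2))" by (simp only: mult.assoc[symmetric]) simp
  moreover have "\<not> int p dvd 2" "\<not> int p dvd 3"
    using assms(2) zdvd_imp_le[of "int p" 2] zdvd_imp_le[of "int p" 3] by auto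
  moreover have "prime (int p)" using assms(1) by simp
  ultimately show ?thesis by (metis prime_dvd_multD)
qed

text \<open>
  A map with multiplier \<open>1\<close> that moves \<open>x\<close> by a unit multiple of \<open>p\<^sup>k\<close> has a \<open>p\<close>-th iterate moving
  it by a unit multiple of \<open>p\<^sup>k\<^sup>+\<^sup>1\<close>, so that the same applies to the iterate. The two error terms
  are harmless because \<open>p\<close> divides the sum of the \<open>i < p\<close> for odd \<open>p\<close>, and the sum of their squares
  for \<open>p \<ge> 5\<close>. For \<open>p = 3\<close> the latter sum is \<open>5\<close>, and the required factor \<open>p\<close> must come from the
  coefficient \<open>p\<^sup>k\<close>, hence \<open>k \<ge> 2\<close>: this is the source of the exceptional behaviour of \<open>3\<close>.
\<close>

lemma iterate_prime_valuation:
  assumes "prime p" "p \<ge> 3" and k: "k \<ge> 1"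
    and "jet2 h x d b" "h x = x + int p ^ k * u" "[d = 1] (mod int p)"
    and "p \<ge> 5 \<or> k \<ge> 2"
  shows "\<exists>u'. (h ^^ p) x = x + int p ^ Suc k * u' \<and> [u' = u] (mod int p)"
proof -
  let ?P = "int p"
  have pq: "?P dvd ?P ^ k" using k by (simp add: dvd_power)
  obtain t where t: "(h ^^ p) x = x + ?P ^ k * t"
    "[t = ?P * u + (d - 1) * u * (\<Sum>i<p. int i) + ?P ^ k * b * u\<^sup>2 * (\<Sum>i<p. (int i)\<^sup>2)] (mod ?P\<^sup>2)"
    using iterate_second_order[OF assms(4,5) pq assms(6), of p] by blast
  obtain a where a: "d - 1 = ?P * a" using assms(6) by (auto simp: cong_iff_dvd_diff)
  obtain s where s: "(\<Sum>i<p. int i) = ?P * s" using sum_below_odd_prime[OF assms(1,2)] by blast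
  obtain v where v: "?P ^ k = ?P * v" using pq by blast
  obtain w where "t - (?P * u + (?P * a) * u * (?P * s)
      + ?P * v * b * u\<^sup>2 * (\<Sum>i<p. (int i)\<^sup>2)) = ?P\<^sup>2 * w"
    using t(2) unfolding cong_iff_dvd_diff a s v by blast
  then have w: "t = ?P * (u + v * b * u\<^sup>2 * (\<Sum>i<p. (int i)\<^sup>2) + ?P * (w + a * u * s))"
    by (simp add: algebra_simps power2_eq_square)
  define u' where "u' = u + v * b * u\<^sup>2 * (\<Sum>i<p. (int i)\<^sup>2) + ?P * (w + a * u * s)"
  have h: "(h ^^ p) x = x + ?P ^ Suc k * u'"
    using t(1) w by (simp add: u'_def)
  have "?P dvd v * (\<Sum>i<p. (int i)\<^sup>2)"
    using assms(7)
  proof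
    assume "p \<ge> 5"
    then show ?thesis using sum_squares_below_prime[OF assms(1)] by simp
  next
    assume "k \<ge> 2"
    then have "?P\<^sup>2 dvd ?P * v" unfolding v[symmetric] by (rule le_imp_power_dvd)
    then have "?P dvd v" using assms(2) by (simp add: power2_eq_square)
    then show ?thesis by simp
  qed
  then have "?P dvd u' - u"
    by (auto simp: u'_def mult.assoc mult.left_commute[of v])
  then show ?thesis
    using h by (auto simp: cong_iff_dvd_diff)
qed

lemma quad_cong:
  assumes "[x = y] (mod q)"
  shows "[(quad c ^^ j) x = (quad c ^^ j) y] (mod q)"
  by (induction j) (use assms in \<open>auto simp: quad_def intro!: cong_add cong_pow\<close>)

text \<open>
  Each round trip of length \<open>N\<close> contributes the same factor modulo \<open>q\<close>, because the starting point
  returns to itself modulo \<open>q\<close>.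
\<close>

lemma multiplier_mult:
  assumes "[(quad c ^^ N) x = x] (mod q)"
  shows "[multiplier c (N * j) x = multiplier c N x ^ j] (mod q)"
proof (induction j)
  case 0
  show ?case by (simp add: multiplier_def)
next
  case (Suc j)
  have ret: "[(quad c ^^ (N * j)) x = x] (mod q)"
  proof (induction j)
    case (Suc j)
    have "(quad c ^^ (N * Suc j)) x = (quad c ^^ N) ((quad c ^^ (N * j)) x)"
      by (simp add: funpow_add)
    also have "[\<dots> = (quad c ^^ N) x] (mod q)" by (rule quad_cong[OF Suc.IH])
    also note assms
    finally show ?case .
  qed simp
  have split: "(\<Prod>i<a + b. g i) = (\<Prod>i<a. g i) * (\<Prod>i<b. g (i + a))" for a b and g :: "nat \<Rightarrow> int"
    by (induction b) (simp_all add: ac_simps)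
  have "multiplier c (N * Suc j) x = (\<Prod>i<N * j + N. 2 * (quad c ^^ i) x)"
    by (simp add: multiplier_def add.commute)
  also have "\<dots> = multiplier c (N * j) x * (\<Prod>i<N. 2 * (quad c ^^ (i + N * j)) x)"
    unfolding multiplier_def by (rule split)
  also have "(\<Prod>i<N. 2 * (quad c ^^ (i + N * j)) x) = multiplier c N ((quad c ^^ (N * j)) x)"
    by (simp add: multiplier_def funpow_add)
  also have "[multiplier c (N * j) x * multiplier c N ((quad c ^^ (N * j)) x)
      = multiplier c N x ^ j * multiplier c N x] (mod q)"
    by (intro cong_mult Suc.IH)
       (unfold multiplier_def, intro cong_prod cong_mult cong_refl quad_cong ret)
  finally show ?case by (simp add: mult.commute)
qed

text \<open>
  In fact \<open>f\<^bsup>N e\<^esup>(x) - x\<close> has \<open>p\<close>-adic valuation exactly \<open>k + v\<^sub>p(e)\<close>: passing to the \<open>p\<close>-th iterate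
  raises the valuation by one, and an exponent prime to \<open>p\<close> keeps it. The bound \<open>k + e\<close> is
  enough to exclude a return and suits an induction on \<open>e\<close>, as \<open>v\<^sub>p(e) < e\<close>.
\<close>

lemma never_returns:
  assumes "prime p" "p \<ge> 3" "k \<ge> 1" "p \<ge> 5 \<or> k \<ge> 2"
    and "[multiplier c N x = 1] (mod int p)"
    and "int p ^ k dvd (quad c ^^ N) x - x" "\<not> int p ^ Suc k dvd (quad c ^^ N) x - x"
    and "e \<ge> 1"
  shows "\<not> int p ^ (k + e) dvd (quad c ^^ (N * e)) x - x"
  using assms(3-)
proof (induction e arbitrary: N k rule: less_induct)
  case (less e)
  let ?P = "int p" and ?h = "quad c ^^ N"
  have P: "prime ?P" "?P \<noteq> 0" using assms(1,2) by auto
  obtain b where b: "jet2 ?h x (multiplier c N x) b" using jet2_quad_iterate by blast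
  obtain u where "?h x - x = ?P ^ k * u" using less.prems(4) by blast
  then have u: "?h x = x + ?P ^ k * u" by simp
  have pu: "\<not> ?P dvd u" using less.prems(5) u P(2) by (auto simp: mult.commute)
  show ?case
  proof (cases "p dvd e")
    case False
    obtain t where t: "(?h ^^ e) x = x + ?P ^ k * t"
        "[t = u * (\<Sum>i<e. multiplier c N x ^ i)] (mod ?P)"
      using iterate_first_order[OF b u, of ?P e] P(2) less.prems(1) by (auto simp: dvd_power)
    note t(2)
    also have "[u * (\<Sum>i<e. multiplier c N x ^ i) = u * (\<Sum>i<e. 1 ^ i)] (mod ?P)"
      by (intro cong_mult cong_sum cong_pow cong_refl less.prems(3))
    finally have "?P dvd t \<longleftrightarrow> ?P dvd u * int e" by (simp add: cong_dvd_iff)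
    then have "\<not> ?P dvd t" using False pu P(1) by (simp add: prime_dvd_mult_iff)
    then have "\<not> ?P ^ Suc k dvd (?h ^^ e) x - x" using t(1) P(2) by (simp add: mult.commute)
    moreover have "?P ^ Suc k dvd ?P ^ (k + e)" using less.prems(6) by (intro le_imp_power_dvd) simp
    ultimately show ?thesis by (metis dvd_trans funpow_mult)
  next
    case True
    then obtain e' where e': "e = p * e'" by blast
    have e1: "e' \<ge> 1" "e' < e" using e' less.prems(6) assms(2) by (auto intro!: Suc_leI)
    obtain u' where u': "(?h ^^ p) x = x + ?P ^ Suc k * u'" "[u' = u] (mod ?P)"
      using iterate_prime_valuation[OF assms(1,2) less.prems(1) b u less.prems(3,2)]
      by blast
    have "\<not> ?P dvd u'" using pu u'(2) by (simp add: cong_dvd_iff)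
    then have nd: "\<not> ?P ^ Suc (Suc k) dvd (quad c ^^ (N * p)) x - x"
      using u'(1) P(2) by (simp add: funpow_mult mult.commute)
    have d: "?P ^ Suc k dvd (quad c ^^ (N * p)) x - x"
      using u'(1) by (simp add: funpow_mult mult.commute)
    have "[?h x = x] (mod ?P)"
      using less.prems(4) power_le_dvd[OF _ less.prems(1)] by (fastforce simp: cong_iff_dvd_diff)
    then have "[multiplier c (N * p) x = multiplier c N x ^ p] (mod ?P)" by (rule multiplier_mult)
    also have "[multiplier c N x ^ p = 1 ^ p] (mod ?P)" by (intro cong_pow less.prems(3))
    finally have "[multiplier c (N * p) x = 1] (mod ?P)" by simp
    then have "\<not> ?P ^ (Suc k + e') dvd (quad c ^^ (N * p * e')) x - x"
      using less.IH[OF e1(2) _ _ _ d nd e1(1)] less.prems(1,2) by linarith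
    moreover have "?P ^ (Suc k + e') dvd ?P ^ (k + e)"
      using e1 by (intro le_imp_power_dvd) simp
    ultimately show ?thesis by (metis dvd_trans e' mult.assoc)
  qed
qed

section \<open>The critical orbit modulo powers of a prime\<close>

locale strictly_preperiodic_mod_p =
  fixes p m n :: nat and c :: "nat \<Rightarrow> int"
  assumes prime: "prime p" and p_ge_3: "p \<ge> 3"
    and c_closed: "c \<in> carrier (Zp p)"
    and type_mod_p: "critical_orbit_type_mod p 1 c m n"
    and m_pos: "m > 0"
begin

definition orb :: "nat \<Rightarrow> nat \<Rightarrow> int" where
  "orb j = (quad_map (Zp p) c ^^ j) \<zero>\<^bsub>Zp p\<^esub>"

lemma p_pos: "p > 0"
  using p_ge_3 by simp

lemma int_prime: "prime (int p)"
  using prime by simp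

lemma orb_closed: "orb j \<in> carrier (Zp p)"
proof -
  interpret cring "Zp p" using cring_Zp[OF p_pos] .
  show ?thesis unfolding orb_def by (rule quad_map_closed[OF ring_axioms c_closed]) simp
qed

lemma orb_0: "orb 0 i = 0"
  by (simp add: orb_def Zp_simps)

lemma orb_Suc: "orb (Suc j) i = ((orb j i)\<^sup>2 + c i) mod int p ^ i"
proof -
  interpret cring "Zp p" using cring_Zp[OF p_pos] .
  have "orb (Suc j) = orb j [^]\<^bsub>Zp p\<^esub> (2::nat) \<oplus>\<^bsub>Zp p\<^esub> c"
    by (simp add: orb_def quad_map_def)
  also have "orb j [^]\<^bsub>Zp p\<^esub> (2::nat) = orb j \<otimes>\<^bsub>Zp p\<^esub> orb j"
    using orb_closed by (simp add: numeral_2_eq_2)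
  finally show ?thesis by (simp add: Zp_simps mod_simps power2_eq_square)
qed

lemma orb_range: "orb j i \<in> {0..<int p ^ i}"
  using orb_closed[of j] by (simp add: Zp_simps)

lemma orb_eq_dvd_iff: "orb a i = orb b i \<longleftrightarrow> int p ^ i dvd orb a i - orb b i"
  by (metis Zp_mod[OF orb_closed] mod_eq_dvd_iff)

text \<open>
  Modulo \<open>p\<^sup>i\<close> the critical orbit is that of an integer quadratic polynomial. The constant term may be
  taken from any level \<open>M \<ge> i\<close>, so one integer polynomial serves all levels up to \<open>M\<close>.
\<close>

lemma orb_quad:
  assumes "i \<le> M"
  shows "[(quad (c M) ^^ j) 0 = orb j i] (mod int p ^ i)"
proof (induction j)
  case 0
  show ?case by (simp add: orb_0)
next
  case (Suc j)
  have "[c M = c i] (mod int p ^ i)"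
    using Zp_mod_le[OF c_closed assms] Zp_mod[OF c_closed] by (simp add: cong_def)
  then have "[((quad (c M) ^^ j) 0)\<^sup>2 + c M = (orb j i)\<^sup>2 + c i] (mod int p ^ i)"
    by (intro cong_add cong_pow Suc.IH)
  then show ?case by (simp add: quad_def[of _ "(quad _ ^^ _) _"] orb_Suc cong_def)
qed

lemma orb_mono:
  assumes "orb a j = orb b j" "i \<le> j"
  shows "orb a i = orb b i"
  using assms Zp_mod_le[OF orb_closed assms(2)] by metis

lemma orb_shift:
  assumes "orb a i = orb b i"
  shows "orb (a + l) i = orb (b + l) i"
  using assms by (induction l) (simp_all add: orb_Suc)

lemma orb_shift_mult:
  assumes "orb (a + d) i = orb a i"
  shows "orb (a + d * l) i = orb a i"
proof (induction l)
  case (Suc l)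
  have "orb (a + d * Suc l) i = orb ((a + d) + d * l) i" by (simp add: ac_simps)
  also have "\<dots> = orb (a + d * l) i" by (rule orb_shift[OF assms])
  finally show ?case using Suc.IH by simp
qed simp

lemma mod_type_iff:
  "critical_orbit_type_mod p i c m' n' \<longleftrightarrow>
     n' \<ge> 1 \<and> orb (m' + n') i = orb m' i \<and>
     (\<forall>a d. d \<ge> 1 \<and> orb (a + d) i = orb a i \<longrightarrow> m' \<le> a \<and> n' \<le> d)"
  using critical_orbit_type_mod_iff[OF p_pos c_closed] unfolding orb_def .

lemma n_pos: "n \<ge> 1"
  and orb_return: "orb (m + n) 1 = orb m 1"
  and orb_minimal: "d \<ge> 1 \<Longrightarrow> orb (a + d) 1 = orb a 1 \<Longrightarrow> m \<le> a \<and> n \<le> d"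
  using type_mod_p unfolding mod_type_iff by blast+

text \<open>
  A return to \<open>0\<close> modulo \<open>p\<close> would make the critical point periodic, against \<open>m > 0\<close>. Hence the
  derivative \<open>2 z\<close> is a unit at every point of the orbit after the first.
\<close>

lemma orb_not_dvd:
  assumes "i \<ge> 1" "a \<ge> 1"
  shows "\<not> int p dvd orb a i"
proof
  assume "int p dvd orb a i"
  then have "orb (0 + a) 1 = orb 0 1"
    using Zp_mod_le[OF orb_closed[of a] assms(1)] by (simp add: orb_0)
  then show False using orb_minimal[OF assms(2)] m_pos by force
qed

lemma return_dvd:
  assumes "i \<ge> 1" "orb (m + d) i = orb m i"
  shows "n dvd d"
proof -
  have "orb (m + d) 1 = orb ((m + n * (d div n)) + d mod n) 1"
    by (simp add: add.assoc)
  also have "\<dots> = orb (m + d mod n) 1" by (rule orb_shift[OF orb_shift_mult[OF orb_return]])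
  finally have "orb (m + d mod n) 1 = orb m 1" using orb_mono[OF assms(2,1)] by simp
  moreover have "d mod n < n" using n_pos by simp
  ultimately have "\<not> d mod n \<ge> 1" using orb_minimal[of "d mod n" m] by linarith
  then show ?thesis by (simp add: dvd_eq_mod_eq_0)
qed

text \<open>
  Modulo \<open>p\<close> the orbit is already periodic at time \<open>m\<close>, so following the cycle onwards leads back
  to the point preceding the coincidence.
\<close>

lemma orb_pull_back_Suc_mod_p:
  assumes "a \<ge> m" "orb (Suc a + d) 1 = orb (Suc a) 1"
  shows "orb (a + d) 1 = orb a 1"
proof -
  define l where "l = m + n * Suc a - Suc a"
  have "1 * Suc a \<le> n * Suc a" using n_pos by (rule mult_le_mono1)
  then have "Suc a \<le> m + n * Suc a" by (simp only: mult_1 trans_le_add2)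
  then have l: "Suc a + l = m + n * Suc a" unfolding l_def by (rule le_add_diff_inverse)
  have "orb (m + d) 1 = orb (m + n * Suc a + d) 1"
    using orb_shift[OF orb_shift_mult[OF orb_return]] by metis
  also have "\<dots> = orb (Suc a + d + l) 1" unfolding l[symmetric] by (simp add: ac_simps)
  also have "\<dots> = orb (Suc a + l) 1" by (rule orb_shift[OF assms(2)])
  also have "\<dots> = orb m 1" unfolding l by (rule orb_shift_mult[OF orb_return])
  finally have "orb ((m + d) + (a - m)) 1 = orb (m + (a - m)) 1" by (rule orb_shift)
  then show ?thesis using assms(1) by (simp add: ac_simps)
qed

text \<open>
  Squaring is injective on a residue class of units: if \<open>x\<^sup>2 \<equiv> y\<^sup>2\<close> modulo \<open>p\<^sup>i\<close> and \<open>x \<equiv> y\<close> modulo \<open>p\<close>,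
  then \<open>x + y \<equiv> 2 y\<close> is a unit and \<open>x \<equiv> y\<close> modulo \<open>p\<^sup>i\<close>. Going back along the cycle keeps the
  points in the same residue class, so a coincidence can be pulled back until time \<open>m\<close>, which shows
  that the tail modulo \<open>p\<^sup>i\<close> is no longer than modulo \<open>p\<close>.
\<close>

lemma orb_pull_back_Suc:
  assumes "i \<ge> 1" "a \<ge> m" "orb (Suc a + d) i = orb (Suc a) i"
  shows "orb (a + d) i = orb a i"
proof -
  let ?x = "orb (a + d) i" and ?y = "orb a i"
  have "[?x\<^sup>2 + c i = ?y\<^sup>2 + c i] (mod int p ^ i)"
    using assms(3) by (simp add: orb_Suc cong_def)
  then have "int p ^ i dvd ?x\<^sup>2 - ?y\<^sup>2" by (simp add: cong_iff_dvd_diff)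
  then have sq: "int p ^ i dvd (?x - ?y) * (?x + ?y)"
    by (simp add: power2_eq_square algebra_simps)
  have "orb (a + d) 1 = orb a 1"
    by (rule orb_pull_back_Suc_mod_p[OF assms(2) orb_mono[OF assms(3,1)]])
  then have d: "int p dvd ?x - ?y"
    using Zp_mod_le[OF orb_closed assms(1)] by (metis mod_eq_dvd_iff power_one_right)
  have "\<not> int p dvd ?x + ?y"
  proof
    assume "int p dvd ?x + ?y"
    then have "int p dvd (?x + ?y) - (?x - ?y)" using d by (rule dvd_diff)
    then have "int p dvd 2 * ?y" by simp
    moreover have "\<not> int p dvd 2" using p_ge_3 zdvd_imp_le[of "int p" 2] by auto
    moreover have "\<not> int p dvd ?y" using orb_not_dvd[OF assms(1)] assms(2) m_pos by simp
    ultimately show False using int_prime by (simp add: prime_dvd_mult_iff)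
  qed
  then have "coprime (int p ^ i) (?x + ?y)"
    using int_prime by (simp add: prime_imp_coprime)
  then have "int p ^ i dvd ?x - ?y" using sq by (simp add: coprime_dvd_mult_left_iff)
  then show ?thesis by (simp add: orb_eq_dvd_iff)
qed

lemma orb_pull_back:
  assumes "i \<ge> 1" "orb (m + l + d) i = orb (m + l) i"
  shows "orb (m + d) i = orb m i"
  using assms(2)
proof (induction l)
  case (Suc l)
  then show ?case using orb_pull_back_Suc[OF assms(1), of "m + l" d] by simp
qed simp

lemma mod_typeI:
  assumes "i \<ge> 1" "\<nu> \<ge> 1" "orb (m + \<nu>) i = orb m i"
    and "\<And>d. d \<ge> 1 \<Longrightarrow> orb (m + d) i = orb m i \<Longrightarrow> \<nu> \<le> d"
  shows "critical_orbit_type_mod p i c m \<nu>"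
  unfolding mod_type_iff
proof (intro conjI allI impI; (elim conjE)?)
  fix a d assume d: "d \<ge> (1::nat)" "orb (a + d) i = orb a i"
  show m: "m \<le> a" using orb_minimal[OF d(1) orb_mono[OF d(2) assms(1)]] ..
  have "orb (m + (a - m) + d) i = orb (m + (a - m)) i" using m d(2) by simp
  then show "\<nu> \<le> d" using assms(4)[OF d(1)] orb_pull_back[OF assms(1)] by blast
qed (use assms in auto)

lemma collision_returns:
  assumes "i \<ge> 1" "a < b" "orb a i = orb b i"
  shows "orb (m + (b - a)) i = orb m i"
proof (rule orb_pull_back[OF assms(1)])
  show "orb (m + a + (b - a)) i = orb (m + a) i"
    using orb_shift[OF assms(3), of m] assms(2) by (simp add: ac_simps)
qed

text \<open>
  The orbit modulo \<open>p\<^sup>i\<close> lies in a finite set, hence two of its points coincide, and pulling the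
  coincidence back to time \<open>m\<close> makes the tail exactly \<open>m\<close>.
\<close>

lemma ex_mod_type:
  assumes "i \<ge> 1"
  shows "\<exists>\<nu>. critical_orbit_type_mod p i c m \<nu>"
proof -
  have "range (\<lambda>j. orb j i) \<subseteq> {0..<int p ^ i}" using orb_range by blast
  then have "finite (range (\<lambda>j. orb j i))" by (rule finite_subset) simp
  then have "\<not> inj (\<lambda>j. orb j i)" using finite_imageD infinite_UNIV_nat by blast
  then obtain a b where "a < b" "orb a i = orb b i"
    by (metis (mono_tags, lifting) injI linorder_neqE_nat)
  then have ex: "b - a \<ge> 1 \<and> orb (m + (b - a)) i = orb m i"
    using collision_returns[OF assms] by simp
  define \<nu> where "\<nu> = (LEAST d. d \<ge> 1 \<and> orb (m + d) i = orb m i)"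
  have "\<nu> \<ge> 1 \<and> orb (m + \<nu>) i = orb m i" unfolding \<nu>_def by (rule LeastI[of _ "b - a"]) (fact ex)
  moreover have "\<nu> \<le> d" if "d \<ge> 1" "orb (m + d) i = orb m i" for d
    unfolding \<nu>_def using that by (intro Least_le) simp
  ultimately show ?thesis using mod_typeI[OF assms] by blast
qed

lemma finite_orbit_returns:
  assumes "finite (critical_orbit p c)"
  obtains d where "d \<ge> 1" "\<And>i. orb (m + d) i = orb m i"
proof -
  have "critical_orbit p c = range orb"
    unfolding critical_orbit_def orb_def ..
  then have "\<not> inj orb" using assms finite_imageD infinite_UNIV_nat by metis
  then obtain a b where ab: "a < b" "orb a = orb b"
    by (metis (mono_tags, lifting) injI linorder_neqE_nat)
  have "orb (m + (b - a)) i = orb m i" for i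
  proof (cases "i \<ge> 1")
    case True
    then show ?thesis using collision_returns ab by simp
  next
    case False
    moreover have "orb j 0 = 0" for j using orb_range[of j 0] by simp
    ultimately show ?thesis by (simp add: not_le)
  qed
  then show ?thesis using that[of "b - a"] ab(1) by simp
qed

subsection \<open>The multiplier of the cycle and the growth of its length\<close>

lemma return_iff_dvd:
  assumes "i \<le> M"
  defines "x \<equiv> (quad (c M) ^^ m) 0"
  shows "orb (m + d) i = orb m i \<longleftrightarrow> int p ^ i dvd (quad (c M) ^^ d) x - x"
proof -
  have "(quad (c M) ^^ d) x = (quad (c M) ^^ (m + d)) 0"
    unfolding x_def by (subst add.commute) (simp add: funpow_add)
  then have "[(quad (c M) ^^ d) x - x = orb (m + d) i - orb m i] (mod int p ^ i)"
    unfolding x_def by (simp only:) (intro cong_diff orb_quad[OF assms(1)])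
  then show ?thesis by (simp add: orb_eq_dvd_iff cong_dvd_iff)
qed

text \<open>
  Taken at level \<open>1\<close>, so that it does not depend on the integer polynomial chosen to approximate the
  map.
\<close>

definition cycle_multiplier :: int where
  "cycle_multiplier = (\<Prod>i<n. 2 * orb (m + i) 1)"

lemma multiplier_cong:
  assumes "M \<ge> 1"
  shows "[multiplier (c M) n ((quad (c M) ^^ m) 0) = cycle_multiplier] (mod int p)"
  unfolding multiplier_def cycle_multiplier_def
proof (intro cong_prod cong_mult cong_refl)
  fix i
  have "(quad (c M) ^^ i) ((quad (c M) ^^ m) 0) = (quad (c M) ^^ (m + i)) 0"
    by (subst add.commute) (simp add: funpow_add)
  then show "[(quad (c M) ^^ i) ((quad (c M) ^^ m) 0) = orb (m + i) 1] (mod int p)"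
    using orb_quad[OF assms] by simp
qed

lemma cycle_multiplier_not_dvd: "\<not> int p dvd cycle_multiplier"
proof -
  have "\<not> int p dvd 2" using p_ge_3 zdvd_imp_le[of "int p" 2] by auto
  then have "\<not> int p dvd 2 * orb (m + i) 1" for i
    using orb_not_dvd[of 1 "m + i"] m_pos int_prime by (simp add: prime_dvd_mult_iff)
  then show ?thesis
    unfolding cycle_multiplier_def using int_prime by (simp add: prime_dvd_prod_iff)
qed

text \<open>
  For \<open>c \<equiv> 0\<close> and \<open>c \<equiv> 2\<close> the critical point is periodic modulo \<open>3\<close>. The remaining case \<open>c \<equiv> 1\<close> has
  the orbit \<open>0, 1, 2, 2, \<dots>\<close>, with fixed point \<open>2\<close> and multiplier \<open>4\<close>.
\<close>

lemma cycle_multiplier_mod_3: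
  assumes "p = 3"
  shows "[cycle_multiplier = 1] (mod int p)"
proof -
  have v: "orb (Suc j) 1 = ((orb j 1)\<^sup>2 + c 1) mod 3" for j using orb_Suc[of j 1] assms by simp
  have o1: "orb 1 1 = c 1 mod 3" using v[of 0] by (simp add: orb_0)
  have "c 1 \<in> {0..<3}" using c_closed assms by (metis Zp_simps(1) atLeastLessThan_iff of_nat_numeral power_one_right)
  then have "c 1 = 0 \<or> c 1 = 1 \<or> c 1 = 2" by auto
  moreover have "c 1 \<noteq> 0" using orb_not_dvd[of 1 1] o1 by auto
  moreover have "c 1 \<noteq> 2" using orb_not_dvd[of 1 2] v[of 1] o1 by (auto simp: numeral_2_eq_2)
  ultimately have c1: "c 1 = 1" by blast
  have o: "orb 1 1 = 1" "orb 2 1 = 2" "orb 3 1 = 2"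
    using o1 c1 v[of 1] v[of 2] by (simp_all add: numeral_2_eq_2 numeral_3_eq_3)
  then have "m \<le> 2 \<and> n \<le> 1" using orb_minimal[of 1 2] by simp
  then have n: "n = 1" and "m = 1 \<or> m = 2" using n_pos m_pos by auto
  moreover have "m \<noteq> 1" using orb_return n o by (auto simp: numeral_2_eq_2)
  ultimately have "m = 2" by blast
  then have "cycle_multiplier = 4" unfolding cycle_multiplier_def using n o by simp
  then show ?thesis using assms by (simp add: cong_def)
qed

text \<open>
  At the first level where the cycle fails to close up after \<open>n\<close> steps, \<open>f\<^sup>n\<close> acts on the lifts of
  the point as \<open>t \<mapsto> u + \<lambda> t\<close> with a unit \<open>u\<close> and \<open>\<lambda>\<close> the multiplier, so the new cycle length is
  \<open>n\<close> times the period of \<open>0\<close> under this affine map.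
\<close>

lemma return_next_level_iff:
  assumes "k \<ge> 1" "orb (m + n) k = orb m k" "orb (m + n) (Suc k) \<noteq> orb m (Suc k)"
  shows "orb (m + n * j) (Suc k) = orb m (Suc k) \<longleftrightarrow> int p dvd (\<Sum>i<j. cycle_multiplier ^ i)"
proof -
  define C where "C = c (Suc k)"
  define x where "x = (quad C ^^ m) 0"
  let ?P = "int p" and ?h = "quad C ^^ n" and ?d = "multiplier C n x"
  have P: "?P \<noteq> 0" using p_pos by simp
  have iff: "orb (m + d) i = orb m i \<longleftrightarrow> ?P ^ i dvd (quad C ^^ d) x - x" if "i \<le> Suc k" for d i
    using return_iff_dvd[OF that] unfolding x_def C_def .
  obtain b where b: "jet2 ?h x ?d b" using jet2_quad_iterate by blast
  obtain u where "?h x - x = ?P ^ k * u" using assms(2) iff[of k n] by auto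
  then have u: "?h x = x + ?P ^ k * u" by simp
  have pu: "\<not> ?P dvd u" using assms(3) iff[of "Suc k" n] u P by (auto simp: mult.commute)
  obtain t where t: "(?h ^^ j) x = x + ?P ^ k * t" "[t = u * (\<Sum>i<j. ?d ^ i)] (mod ?P)"
    using iterate_first_order[OF b u, of ?P j] P assms(1) by (auto simp: dvd_power)
  note t(2)
  also have "[u * (\<Sum>i<j. ?d ^ i) = u * (\<Sum>i<j. cycle_multiplier ^ i)] (mod ?P)"
    unfolding x_def C_def by (intro cong_mult cong_sum cong_pow cong_refl multiplier_cong) simp
  finally have "?P dvd t \<longleftrightarrow> ?P dvd u * (\<Sum>i<j. cycle_multiplier ^ i)" by (rule cong_dvd_iff)
  moreover have "orb (m + n * j) (Suc k) = orb m (Suc k) \<longleftrightarrow> ?P dvd t"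
    using iff[of "Suc k" "n * j"] t(1) P by (simp add: funpow_mult mult.commute)
  ultimately show ?thesis using pu int_prime by (simp add: prime_dvd_mult_iff)
qed

text \<open>
  If the return failed for the first time at a level above \<open>k\<close>, then \<open>never_returns\<close> would apply to
  \<open>f\<^bsup>n r\<^esup>\<close> at that level and forbid the assumed return after \<open>d\<close> steps.
\<close>

lemma return_persists:
  assumes d: "d \<ge> 1" "\<And>i. orb (m + d) i = orb m i"
    and k: "k \<ge> 1" "p \<ge> 5 \<or> k \<ge> 2" "[cycle_multiplier ^ r = 1] (mod int p)"
    and ret: "orb (m + n * r) k = orb m k"
  shows "orb (m + n * r) j = orb m j"
proof (cases "j \<le> k")
  case True
  then show ?thesis using orb_mono[OF ret] by blast
next
  case False
  then have "k \<le> j" by simp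
  then show ?thesis
  proof (induction j rule: dec_induct)
    case base
    show ?case by (rule ret)
  next
    case (step i)
    show ?case
    proof (rule ccontr)
      assume neq: "orb (m + n * r) (Suc i) \<noteq> orb m (Suc i)"
      \<comment> \<open>With \<open>e = d\<close>, \<open>never_returns\<close> excludes a return after \<open>n r d\<close> steps at level \<open>i + d\<close>.\<close>
      define M where "M = i + d"
      define C where "C = c M"
      define x where "x = (quad C ^^ m) 0"
      have iff: "orb (m + d) i = orb m i \<longleftrightarrow> int p ^ i dvd (quad C ^^ d) x - x" if "i \<le> M" for d i
        using return_iff_dvd[OF that] unfolding x_def C_def .
      have "M \<ge> 1" using d(1) M_def by simp
      have "[(quad C ^^ n) x = x] (mod int p)"
        using iff[of 1 n] orb_return \<open>M \<ge> 1\<close> by (simp add: cong_iff_dvd_diff)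
      then have "[multiplier C (n * r) x = multiplier C n x ^ r] (mod int p)"
        by (rule multiplier_mult)
      also have "[multiplier C n x ^ r = cycle_multiplier ^ r] (mod int p)"
        unfolding x_def C_def by (intro cong_pow multiplier_cong \<open>M \<ge> 1\<close>)
      also note k(3)
      finally have "\<not> int p ^ (i + d) dvd (quad C ^^ (n * r * d)) x - x"
        using step k(1,2) neq d(1) iff[of i "n * r"] iff[of "Suc i" "n * r"]
        by (intro never_returns[OF prime p_ge_3]) (auto simp: M_def)
      moreover have "orb (m + d * (n * r)) M = orb m M"
        by (rule orb_shift_mult[OF d(2)])
      ultimately show False using iff[of M "d * (n * r)"] by (simp add: M_def mult.commute)
    qed
  qed
qed

text \<open>
  The factor \<open>r\<close> is the period of \<open>0\<close> under \<open>t \<mapsto> u + \<lambda> t\<close> modulo \<open>p\<close>. If \<open>\<lambda> \<equiv> 1\<close>, this is \<open>p\<close>; but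
  then a periodic orbit that fails to close up at level \<open>k + 1\<close> is possible only for \<open>p = 3\<close> and
  \<open>k = 1\<close>. If \<open>\<lambda>\<close> is not \<open>1\<close>, it is the multiplicative order of \<open>\<lambda>\<close>, a divisor of \<open>p - 1\<close>, and
  \<open>p \<noteq> 3\<close>. In both cases \<open>f\<^bsup>n r\<^esup>\<close> has multiplier \<open>1\<close> and closes up at a level \<open>k + 1 \<ge> 2\<close>, which forces
  it to close up at every level.
\<close>

lemma finite_orbit_mod_types:
  assumes d: "d \<ge> 1" "\<And>i. orb (m + d) i = orb m i"
    and k: "k \<ge> 1" "orb (m + n) k = orb m k" "orb (m + n) (Suc k) \<noteq> orb m (Suc k)"
  shows "\<exists>r. r > 0 \<and> (if p = 3 then r = p else r dvd p - 1) \<and>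
    (\<forall>j. orb (m + n * r) j = orb m j) \<and>
    (\<forall>j\<ge>1. orb (m + n * j) (Suc k) = orb m (Suc k) \<longrightarrow> r \<le> j)"
proof (cases "[cycle_multiplier = 1] (mod int p)")
  case True
  have "\<not> (p \<ge> 5 \<or> k \<ge> 2)"
    using return_persists[OF d k(1), of 1 "Suc k"] True k(2,3) by auto
  moreover have "p \<noteq> 4" using prime by (auto simp: prime_nat_iff dest: spec[of _ 2])
  ultimately have p: "p = 3" and k1: "k = 1" using p_ge_3 k(1) by auto
  have iff: "orb (m + n * j) (Suc k) = orb m (Suc k) \<longleftrightarrow> p dvd j" for j
  proof -
    have "[(\<Sum>i<j. cycle_multiplier ^ i) = (\<Sum>i<j. 1 ^ i)] (mod int p)"
      by (intro cong_sum cong_pow True)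
    then show ?thesis using return_next_level_iff[OF k] by (simp add: cong_dvd_iff)
  qed
  have "orb (m + n * p) j = orb m j" for j
    using return_persists[OF d, of "Suc k" p] iff[of p] k1 cong_pow[OF True, of p] by simp
  then show ?thesis using p p_pos iff by (intro exI[of _ p]) (auto dest: dvd_imp_le)
next
  case False
  then have p: "p \<noteq> 3" using cycle_multiplier_mod_3 by blast
  moreover have "p \<noteq> 4" using prime by (auto simp: prime_nat_iff dest: spec[of _ 2])
  ultimately have p5: "p \<ge> 5" using p_ge_3 by simp
  define l where "l = nat (cycle_multiplier mod int p)"
  have l: "[int l = cycle_multiplier] (mod int p)" using p_pos by (simp add: l_def cong_def)
  have pow: "[cycle_multiplier ^ j = 1] (mod int p) \<longleftrightarrow> ord p l dvd j" for j
  proof -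
    have "[cycle_multiplier ^ j = 1] (mod int p) \<longleftrightarrow> [int l ^ j = 1] (mod int p)"
      by (metis cong_pow cong_sym cong_trans l)
    also have "\<dots> \<longleftrightarrow> [l ^ j = 1] (mod p)" by (metis cong_int_iff of_nat_1 of_nat_power)
    also have "\<dots> \<longleftrightarrow> ord p l dvd j" by (rule ord_divides)
    finally show ?thesis .
  qed
  have "\<not> int p dvd int l" using cycle_multiplier_not_dvd cong_dvd_iff[OF l] by simp
  then have cop: "coprime p l" using prime by (simp add: prime_imp_coprime)
  have iff: "orb (m + n * j) (Suc k) = orb m (Suc k) \<longleftrightarrow> ord p l dvd j" for j
  proof -
    have "\<not> int p dvd cycle_multiplier - 1" using False by (simp add: cong_iff_dvd_diff)
    then have "int p dvd (\<Sum>i<j. cycle_multiplier ^ i) \<longleftrightarrow>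
        int p dvd (cycle_multiplier - 1) * (\<Sum>i<j. cycle_multiplier ^ i)"
      using int_prime by (simp add: prime_dvd_mult_iff)
    also have "\<dots> \<longleftrightarrow> [cycle_multiplier ^ j = 1] (mod int p)"
      by (simp add: power_diff_1_eq[symmetric] cong_iff_dvd_diff)
    finally show ?thesis using return_next_level_iff[OF k] pow by simp
  qed
  have "orb (m + n * ord p l) j = orb m j" for j
    using return_persists[OF d, of "Suc k" "ord p l"] iff[of "ord p l"] pow[of "ord p l"] p5 by simp
  moreover have "ord p l dvd p - 1"
    using order_divides_totient[OF cop] prime by (simp add: totient_prime)
  moreover have "ord p l > 0" using cop by (simp add: ord_eq_0 coprime_commute)
  ultimately show ?thesis using p iff by (intro exI[of _ "ord p l"]) (auto dest: dvd_imp_le)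
qed

end

section \<open>The three possibilities for the critical orbit\<close>

theorem theorem1p1:
  fixes p m n :: nat and c :: "nat \<Rightarrow> int"
  assumes "prime p" and "p \<ge> 3"
    and "c \<in> carrier (Zp p)"
    and "critical_orbit_type_mod p 1 c m n" and "m > 0"
  shows
    "critical_orbit_type p c m n
     \<or> (\<exists>k r :: nat. k \<ge> 1 \<and> r > 0 \<and> (if p = 3 then r = p else r dvd p - 1)
          \<and> (\<forall>i. 1 \<le> i \<and> i \<le> k \<longrightarrow> critical_orbit_type_mod p i c m n)
          \<and> (\<forall>j. j > k \<longrightarrow> critical_orbit_type_mod p j c m (r * n)))
     \<or> (infinite (critical_orbit p c)
          \<and> (\<exists>\<nu> :: nat \<Rightarrow> nat. \<forall>i\<ge>1. critical_orbit_type_mod p i c m (\<nu> i)))"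
proof -
  interpret strictly_preperiodic_mod_p p m n c
    using assms by unfold_locales
  show ?thesis
  proof (cases "infinite (critical_orbit p c)")
    case True
    then show ?thesis using ex_mod_type by metis
  next
    case False
    then obtain d where d: "d \<ge> 1" "\<And>i. orb (m + d) i = orb m i"
      using finite_orbit_returns by blast
    show ?thesis
    proof (cases "orb (m + n) = orb m")
      case True
      have "m \<le> m' \<and> n \<le> n'" if "n' \<ge> 1" "orb (m' + n') = orb m'" for m' n'
        using orb_minimal[OF that(1), of m'] that(2) by simp
      then have "critical_orbit_type p c m n"
        using True n_pos by (auto simp: critical_orbit_type_def orbit_type_def orb_def)
      then show ?thesis ..
    next
      case False
      then obtain i where i: "orb (m + n) i \<noteq> orb m i" by blast
      \<comment> \<open>The index is shifted by one: the cycle closes up at level \<open>k\<close> and fails to at \<open>k + 1\<close>.\<close>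
      define k where "k = (LEAST i. orb (m + n) (Suc i) \<noteq> orb m (Suc i))"
      have "orb (m + n) (Suc i) \<noteq> orb m (Suc i)" using i orb_mono[of "m + n" "Suc i" m i] by auto
      then have k1: "orb (m + n) (Suc k) \<noteq> orb m (Suc k)" unfolding k_def by (rule LeastI)
      have "k \<noteq> 0" using k1 orb_return by (intro notI) simp
      then obtain k' where k': "k = Suc k'" by (cases k) auto
      then have "k' < (LEAST i. orb (m + n) (Suc i) \<noteq> orb m (Suc i))" by (simp flip: k_def)
      then have k2: "orb (m + n) k = orb m k"
        unfolding k' by (rule not_less_Least[THEN notnotD])
      have k: "k \<ge> 1" using k' by simp
      obtain r where r: "r > 0" "if p = 3 then r = p else r dvd p - 1"
          "\<And>j. orb (m + n * r) j = orb m j"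
          "\<And>j. j \<ge> 1 \<Longrightarrow> orb (m + n * j) (Suc k) = orb m (Suc k) \<Longrightarrow> r \<le> j"
        using finite_orbit_mod_types[OF d k k2 k1] by blast
      have "critical_orbit_type_mod p i c m n" if "1 \<le> i" "i \<le> k" for i
        using that(1) n_pos orb_mono[OF k2 that(2)]
      proof (rule mod_typeI)
        fix d assume "d \<ge> 1" "orb (m + d) i = orb m i"
        then show "n \<le> d" using return_dvd[OF that(1)] by (auto intro: dvd_imp_le)
      qed
      moreover have "critical_orbit_type_mod p j c m (r * n)" if j: "j > k" for j
      proof (rule mod_typeI)
        show "j \<ge> 1" "r * n \<ge> 1" using j r(1) n_pos by (auto simp: Suc_le_eq)
        show "orb (m + r * n) j = orb m j" using r(3) by (simp add: mult.commute)
        fix d assume d: "d \<ge> 1" "orb (m + d) j = orb m j"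
        then obtain e where e: "d = n * e" using return_dvd \<open>j \<ge> 1\<close> by blast
        then have "e \<ge> 1" using d(1) by (cases e) auto
        then have "r \<le> e" using r(4) orb_mono[OF d(2), of "Suc k"] j e by simp
        then show "r * n \<le> d" using e by (simp add: mult.commute)
      qed
      ultimately show ?thesis using k r(1,2) by blast
    qed
  qed
qed

end
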